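(* Let $q$ be a prime power and let $n,k,s,t,g,h$ be positive integers with $\gcd(n,s)=\gcd(n,t)=1$ and $k\in\{2,n-2\}$. Let $\eta,\theta\in\mathbb{F}_{q^n}$ satisfy $N_{q^{sn}/q^s}(\eta)\neq(-1)^{nk}$ and $N_{q^{tn}/q^t}(\theta)\neq(-1)^{nk}$. Assume $s\not\equiv\pm t\pmod n$. If at most one of $\eta,\theta$ is nonzero, or if $n\neq5$, then $\mathcal{H}_{k,s}(\eta,g)$ and $\mathcal{H}_{k,t}(\theta,h)$ are not equivalent.
   Context: All polynomials are $q$-polynomials over $\mathbb{F}_{q^n}$, i.e. $\sum_{i=0}^{n-1}a_ix^{q^i}$ with $a_i\in\mathbb{F}_{q^n}$, considered modulo $x^{q^n}-x$. $N_{q^{sn}/q^s}(\eta)=\eta^{1+q^s+\dots+q^{s(n-1)}}$. For integers $k,s,h$ and $\eta\in\mathbb{F}_{q^n}$, $\mathcal{H}_{k,s}(\eta,h)=\{a_0x+a_1x^{q^s}+\dots+a_{k-1}x^{q^{s(k-1)}}+\eta a_0^{q^h}x^{q^{sk}} : a_0,\dots,a_{k-1}\in\mathbb{F}_{q^n}\}$. Two sets $\mathcal{C},\mathcal{C}'$ of $q$-polynomials over $\mathbb{F}_{q^n}$ are equivalent if there exist permutation $q$-polynomials $L_1,L_2$ (inducing bijections of $\mathbb{F}_{q^n}$) and $\rho\in\mathrm{Aut}(\mathbb{F}_q)$ with $\mathcal{C}'=\{L_1\circ f^\rho\circ L_2: f\in\mathcal{C}\}$, where $(\sum a_ix^{q^i})^\rho:=\sum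 a_i^\rho x^{q^i}$. *)

theory Defs
  imports "HOL-Computational_Algebra.Computational_Algebra" "HOL-Number_Theory.Cong"
    "HOL-Number_Theory.Prime_Powers"
begin

text \<open>
  Throughout, the type \<open>'a\<close> plays the role of the field with \<open>q ^ n\<close> elements. A \<open>q\<close>-polynomial
  is represented by its unique representative modulo \<open>x ^ (q ^ n) - x\<close> of degree below \<open>q ^ n\<close>;
  sums are automatically reduced, but compositions and high powers of \<open>x\<close> have to be reduced
  explicitly.
\<close>

definition q_modulus :: "nat \<Rightarrow> nat \<Rightarrow> 'a::field poly" where
  "q_modulus q n = monom 1 (q ^ n) - monom 1 1"

definition q_polys :: "nat \<Rightarrow> nat \<Rightarrow> 'a::field poly set" where
  "q_polys q n = {\<Sum>i<n. monom (a i) (q ^ i) | a. True}"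

definition perm_q_polys :: "nat \<Rightarrow> nat \<Rightarrow> 'a::field poly set" where
  "perm_q_polys q n = {L \<in> q_polys q n. bij (poly L)}"

definition rel_norm :: "nat \<Rightarrow> nat \<Rightarrow> nat \<Rightarrow> 'a::field \<Rightarrow> 'a" where
  "rel_norm q n s \<eta> = \<eta> ^ (\<Sum>i<n. q ^ (s * i))"

definition twisted_code :: "nat \<Rightarrow> nat \<Rightarrow> nat \<Rightarrow> nat \<Rightarrow> 'a::field \<Rightarrow> nat \<Rightarrow> 'a poly set" where
  "twisted_code q n k s \<eta> h =
     {((\<Sum>i<k. monom (a i) (q ^ (s * i))) + monom (\<eta> * a 0 ^ (q ^ h)) (q ^ (s * k)))
        mod q_modulus q n | a. True}"

definition field_aut_on :: "'a::field set \<Rightarrow> ('a \<Rightarrow> 'a) \<Rightarrow> bool" where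
  "field_aut_on F \<rho> \<longleftrightarrow> bij_betw \<rho> F F \<and>
     (\<forall>x\<in>F. \<forall>y\<in>F. \<rho> (x + y) = \<rho> x + \<rho> y \<and> \<rho> (x * y) = \<rho> x * \<rho> y)"

definition base_field :: "nat \<Rightarrow> 'a::field set" where
  "base_field q = {x. x ^ q = x}"

text \<open>
  An automorphism of the field with \<open>q\<close> elements acts on coefficients in the field with \<open>q ^ n\<close>
  elements through an extension to the latter; \<open>\<rho>\<close> below is such an extension. Every automorphism
  of the large field restricts to the small one. Which extension is taken is immaterial: two of
  them differ by a power of \<open>y \<mapsto> y ^ q\<close>, and applying the latter to the coefficients of \<open>f\<close> amounts
  to replacing \<open>f\<close> by \<open>x ^ q \<circ> f \<circ> x ^ (q ^ (n - 1))\<close>, which can be absorbed in \<open>L\<^sub>1\<close> and \<open>L\<^sub>2\<close>.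
\<close>

definition code_equiv :: "nat \<Rightarrow> nat \<Rightarrow> 'a::field poly set \<Rightarrow> 'a poly set \<Rightarrow> bool" where
  "code_equiv q n C C' \<longleftrightarrow>
     (\<exists>L\<^sub>1 \<in> perm_q_polys q n. \<exists>L\<^sub>2 \<in> perm_q_polys q n. \<exists>\<rho>.
        field_aut_on UNIV \<rho> \<and> field_aut_on (base_field q) \<rho> \<and>
        C' = {(L\<^sub>1 \<circ>\<^sub>p (map_poly \<rho> f \<circ>\<^sub>p L\<^sub>2)) mod q_modulus q n | f. f \<in> C})"

end

theory Submission
  imports Defs
begin

text \<open>
  Only the inclusion of the image of the first code in the second one is used, and only through
  supports. Let \<open>U\<close> and \<open>V\<close> be the sets of exponents, modulo \<open>n\<close>, occurring in \<open>L\<^sub>1\<close> and \<open>L\<^sub>2\<close>.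
  Composing \<open>L\<^sub>1\<close>, a monomial with free coefficient \<open>b\<close>, and \<open>L\<^sub>2\<close>, and comparing coefficients of
  \<open>b ^ (q ^ l) * x ^ (q ^ m)\<close>, one gets linear conditions each of which involves at most two
  products of a coefficient of \<open>L\<^sub>1\<close> with one of \<open>L\<^sub>2\<close>. Hence \<open>U + V + s \<subseteq> {0, t, 2 * t}\<close> when
  \<open>k = 2\<close>, and the twists \<open>\<eta>\<close>, \<open>\<theta>\<close> relate membership of \<open>z\<close> and \<open>z - 2 * s\<close> in \<open>U + V\<close>. A
  nonempty \<open>U + V\<close> with these properties forces \<open>s = 2 * t\<close> or \<open>s = - 2 * t\<close>, and then \<open>n = 5\<close>
  with both twists nonzero. The case \<open>k = n - 2\<close> satisfies the same constraints up to a reflection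
  and an exchange of \<open>s\<close> and \<open>t\<close>.
\<close>

section \<open>Arithmetic of the sumset of exponents\<close>

text \<open>In the case \<open>k = 2\<close>, \<open>w\<close> is membership in
  \<open>U + V\<close>, \<open>A\<close> and \<open>B\<close> say that the first and second twist
  are nonzero, and \<open>P\<close> describes the exponents of the second code. Some element of the
  sumset satisfies \<open>P\<close>; with \<open>shift\<close> this makes \<open>s\<close> a small
  multiple of \<open>t\<close>, and the twist relations then lead out of \<open>P\<close>.\<close>

lemma no_sumset_support:
  fixes s t N :: int and w :: "int \<Rightarrow> bool" and A B :: bool
  defines "P \<equiv> \<lambda>z. \<exists>c\<in>(if B then {0, 1, 2} else {0, 1}). N dvd z - c * t"
  assumes N: "N = 5 \<or> N \<ge> 7"
    and cop: "coprime s N" "coprime t N"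
    and st: "\<not> N dvd s - t" "\<not> N dvd s + t"
    and AB: "\<not> A \<or> \<not> B \<or> N \<noteq> 5"
    and periodic: "\<And>x y. w x \<Longrightarrow> N dvd x - y \<Longrightarrow> w y"
    and shift: "\<And>z. w z \<Longrightarrow> P (z + s)"
    and down: "\<And>z. w z \<Longrightarrow> P z \<or> A \<and> w (z - 2 * s)"
    and up: "\<And>z. A \<Longrightarrow> w z \<Longrightarrow> P (z + 2 * s) \<or> w (z + 2 * s)"
    and twist: "B \<Longrightarrow> w (2 * t - s) \<longleftrightarrow> w (- s)"
  shows "\<not> w z"
proof
  assume wz: "w z"
  have unit: "N dvd c" if "N dvd c * d" "d = s \<or> d = t" for c d
    using that cop by (auto simp: coprime_dvd_mult_left_iff coprime_commute)
  have small: "\<not> N dvd c" if "c \<in> {1, 2, 3, 4, 6, -1, -2, -3, -4, -6}" for c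
  proof
    assume "N dvd c"
    thus False
      using N that zdvd_imp_le[of N 2] zdvd_imp_le[of N 3] zdvd_imp_le[of N 4] zdvd_imp_le[of N 6]
      by (auto dest: zdvd_imp_le)
  qed
  have small5: "\<not> N dvd c" if "c \<in> {5, -5}" "N \<noteq> 5" for c
  proof
    assume "N dvd c"
    hence "N dvd 5" using that by auto
    thus False using N zdvd_imp_le[of N 5] that by auto
  qed
  \<comment> \<open>Otherwise \<open>down\<close> keeps the progression with difference
    \<open>- 2 * s\<close> inside \<open>w\<close>. By \<open>shift\<close>, its first four terms
    share three residue classes, so \<open>N\<close> would divide 2, 4 or 6.\<close>
  have "\<exists>z. w z \<and> P z"
  proof (rule ccontr)
    assume "\<not> ?thesis"
    hence step: "w (z - 2 * s)" if "w z" for z using down that by blast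
    have orbit: "w (z - 2 * s * int j)" for j
    proof (induction j)
      case (Suc j)
      thus ?case using step[of "z - 2 * s * int j"] by (simp add: algebra_simps)
    qed (use wz in simp)
    have "\<exists>c\<in>{0, 1, 2}. N dvd (z - 2 * s * int j + s) - c * t" for j
      using shift[OF orbit[of j]] unfolding P_def by (auto split: if_splits)
    then obtain c where c: "c j \<in> {0, 1, 2}" "N dvd (z - 2 * s * int j + s) - c j * t" for j
      by metis
    have "\<not> inj_on c {..<4::nat}"
    proof (rule pigeonhole)
      have "card (c ` {..<4}) \<le> card {0, 1, 2::int}"
        using c(1) by (intro card_mono) auto
      thus "card (c ` {..<4}) < card {..<4::nat}" by simp
    qed
    then obtain i j where ij: "i < 4" "j < 4" "i \<noteq> j" "c i = c j"
      by (auto simp: inj_on_def)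
    have "N dvd (2 * (int j - int i)) * s"
      using dvd_diff[OF c(2)[of i] c(2)[of j]] ij by (simp add: algebra_simps)
    hence "N dvd 2 * (int j - int i)" using unit by blast
    moreover have "2 * (int j - int i) \<in> {2, 4, 6, -2, -4, -6}"
    proof -
      have "i \<in> {0, 1, 2, 3}" "j \<in> {0, 1, 2, 3}" using ij by auto
      thus ?thesis using ij(3) by auto
    qed
    ultimately show False using small by auto
  qed
  then obtain z where z: "w z" "P z" by blast
  obtain a where a: "a \<in> (if B then {0, 1, 2} else {0, 1})" "N dvd z - a * t"
    using z(2) unfolding P_def by blast
  obtain b where b: "b \<in> (if B then {0, 1, 2} else {0, 1})" "N dvd z + s - b * t"
    using shift[OF z(1)] unfolding P_def by blast
  have s: "N dvd s - (b - a) * t"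
    using dvd_diff[OF b(2) a(2)] by (simp add: algebra_simps)
  \<comment> \<open>These differences would make \<open>N\<close> divide the unit \<open>s\<close>,
    or \<open>s - t\<close>, or \<open>s + t\<close>. Only 2 and -2 remain, which forces
    \<open>B\<close>.\<close>
  have "b - a \<notin> {0, 1, -1}"
    using s st unit[of 1 s] small[of 1] by auto
  with a(1) b(1) have ab: "B \<and> (a = 0 \<and> b = 2 \<or> a = 2 \<and> b = 0)"
    by (auto split: if_splits)
  hence P: "P x \<longleftrightarrow> N dvd x \<or> N dvd x - t \<or> N dvd x - 2 * t" for x
    by (simp add: P_def)
  \<comment> \<open>With \<open>y\<close> equal to \<open>s - 2 * t\<close> or
    \<open>s + 2 * t\<close>, \<open>x\<close> is \<open>c * t\<close> modulo \<open>N\<close>;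
    cancelling the unit \<open>t\<close>, \<open>P x\<close> puts \<open>c\<close> among 0, 1,
    2.\<close>
  have multiple: "N dvd c \<or> N dvd c - 1 \<or> N dvd c - 2" if "P x" "N dvd y" "x + e * y = c * t" for x y e c
  proof -
    have "N dvd d" if "N dvd x - (c - d) * t" for d
    proof -
      have "N dvd (x - (c - d) * t) + e * y"
        using that \<open>N dvd y\<close> by (intro dvd_add dvd_mult)
      moreover have "(x - (c - d) * t) + e * y = d * t"
        using \<open>x + e * y = c * t\<close> by (simp add: algebra_simps)
      ultimately have "N dvd d * t" by simp
      thus ?thesis using unit by blast
    qed
    from this[of c] this[of "c - 1"] this[of "c - 2"] show ?thesis
      using \<open>P x\<close> unfolding P by (simp add: algebra_simps) blast
  qed
  show False
  proof (cases "a = 0")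
    case True
    with ab a b s have s2: "N dvd s - 2 * t" and z0: "N dvd z" by auto
    \<comment> \<open>Without \<open>A\<close>, \<open>twist\<close> carries
      \<open>2 * t - s = 0\<close> to \<open>- s = - 2 * t\<close>, which violates \<open>P\<close>.
      With \<open>A\<close>, \<open>up\<close> and \<open>shift\<close> put \<open>4 * t\<close> or
      \<open>6 * t\<close> into \<open>P\<close>; the second is possible only for
      \<open>N = 5\<close>, where the twists are not both nonzero.\<close>
    show False
    proof (cases A)
      case False
      have "w (2 * t - s)"
        using periodic[OF z(1), of "2 * t - s"] dvd_add[OF z0 s2] by (simp add: algebra_simps)
      hence "w (- s)" using twist ab by blast
      hence "P (- s)" using down False by blast
      thus False
        using multiple[OF _ s2, of "- s" "1" "-2"] small[of "-2"] small[of "-3"] small[of "-4"] by simp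
    next
      case True
      have "w 0" using periodic[OF z(1)] z0 by auto
      hence "P (2 * s) \<or> P (3 * s)" using up[OF True, of 0] shift[of "2 * s"] by auto
      thus False
        using multiple[OF _ s2, of "2 * s" "-2" "4"] multiple[OF _ s2, of "3 * s" "-3" "6"]
          small[of "2"] small[of "3"] small[of "4"] small[of "6"] small5[of 5] True ab AB by (auto simp: algebra_simps)
    qed
  next
    case False
    with ab a b s have s2: "N dvd s + 2 * t" and z0: "N dvd z - 2 * t" by auto
    \<comment> \<open>Mirror image: the multiples of \<open>t\<close> reached are 4 without
      \<open>A\<close>, and -2 or -4 with it.\<close>
    show False
    proof (cases A)
      case False
      have "w (- s)"
        using periodic[OF z(1), of "- s"] dvd_add[OF z0 s2] by (simp add: algebra_simps)
      hence "w (2 * t - s)" using twist ab by blast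
      hence "P (2 * t - s)" using down False by blast
      thus False
        using multiple[OF _ s2, of "2 * t - s" "1" "4"] small[of "4"] small[of "3"] small[of "2"] by simp
    next
      case True
      have "w (2 * t)" using periodic[OF z(1)] z0 by auto
      hence "P (2 * t + 2 * s) \<or> P (2 * t + 3 * s)" using up[OF True, of "2 * t"] shift[of "2 * t + 2 * s"]
          by (auto simp: algebra_simps)
      thus False
        using multiple[OF _ s2, of "2 * t + 2 * s" "-2" "-2"] multiple[OF _ s2, of "2 * t + 3 * s" "-3" "-4"]
          small[of "-2"] small[of "-3"] small[of "-4"] small[of "-6"] small5[of "-5"] True ab AB by (auto simp: algebra_simps)
    qed
  qed
qed

section \<open>Frobenius powers on a finite field\<close>

lemma finite_field_power_card:
  fixes x :: "'a::{field, finite}"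
  shows "x ^ card (UNIV :: 'a set) = x"
proof (cases "x = 0")
  case False
  have "(\<Prod>y\<in>UNIV-{0}. x * y) = (\<Prod>y\<in>UNIV-{0::'a}. y)"
    by (rule prod.reindex_bij_witness[of _ "\<lambda>y. y / x" "\<lambda>y. x * y"]) (use False in auto)
  moreover have "(\<Prod>y\<in>UNIV-{0::'a}. y) \<noteq> 0" by simp
  ultimately have "x ^ (card (UNIV :: 'a set) - 1) = 1"
    by (simp add: prod.distrib)
  moreover have "card (UNIV :: 'a set) = Suc (card (UNIV :: 'a set) - 1)"
    by (simp add: finite_UNIV_card_ge_0)
  ultimately show ?thesis by (metis mult.right_neutral power_Suc)
qed (simp add: finite_UNIV_card_ge_0)

lemma CHAR_dvd_card_finite: "CHAR('a::{field, finite}) dvd card (UNIV :: 'a set)"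
proof -
  have "(\<Sum>y\<in>UNIV. y + 1) = (\<Sum>y\<in>UNIV. y :: 'a)"
    by (rule sum.reindex_bij_witness[of _ "\<lambda>y. y - 1" "\<lambda>y. y + 1"]) auto
  hence "of_nat (card (UNIV :: 'a set)) = (0 :: 'a)"
    by (simp add: sum.distrib)
  thus ?thesis by (simp add: of_nat_eq_0_iff_char_dvd)
qed

locale frobenius_field =
  fixes q n :: nat and ty :: "'a::{field, finite} itself"
  assumes primepow_q: "primepow q" and card_UNIV: "card (UNIV :: 'a set) = q ^ n" and n_pos: "0 < n"
begin

lemma prime_CHAR: "prime CHAR('a)"
  using finite_imp_CHAR_pos[where ?'a = 'a] prime_CHAR_semidom[where ?'a = 'a] by simp

lemma q_gt_1: "q > 1"
  using primepow_gt_Suc_0[OF primepow_q] by simp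

text \<open>Counting the field identifies the prime below \<open>q\<close> with the characteristic,
  which makes \<open>x ^ q\<close> additive.\<close>

lemma q_eq_CHAR_power: obtains r where "q = CHAR('a) ^ r"
proof -
  from primepow_q obtain p r where p: "prime p" "q = p ^ r"
    by (auto simp: primepow_def)
  have "CHAR('a) dvd p ^ (r * n)"
    using CHAR_dvd_card_finite[where ?'a = 'a] p by (simp add: card_UNIV power_mult)
  hence "CHAR('a) = p"
    using prime_CHAR p by (metis prime_dvd_power primes_dvd_imp_eq)
  with p that show thesis by blast
qed

text \<open>Reducing integer exponents modulo \<open>n\<close> gives an action of the integers
  modulo \<open>n\<close>, so indices can be subtracted freely.\<close>

definition frob :: "int \<Rightarrow> 'a \<Rightarrow> 'a" where
  "frob i x = x ^ (q ^ nat (i mod int n))"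

lemma power_q_power_mod: "(x :: 'a) ^ (q ^ j) = x ^ (q ^ (j mod n))"
proof -
  have cycle: "y ^ (q ^ (n * c)) = y" for y :: 'a and c
    by (induction c) (simp_all add: power_add power_mult finite_field_power_card flip: card_UNIV)
  have "x ^ (q ^ j) = x ^ (q ^ (n * (j div n) + j mod n))" by simp
  also have "\<dots> = (x ^ (q ^ (n * (j div n)))) ^ (q ^ (j mod n))"
    by (simp only: power_add power_mult)
  finally show ?thesis by (simp only: cycle)
qed

lemma power_q_power: "(x :: 'a) ^ (q ^ j) = frob (int j) x"
  unfolding frob_def by (subst power_q_power_mod) (simp add: nat_mod_distrib)

lemma frob_frob: "frob i (frob j x) = frob (i + j) x"
proof -
  have "frob i (frob j x) = x ^ (q ^ (nat (j mod int n) + nat (i mod int n)))"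
    by (simp add: frob_def power_add power_mult)
  also have "\<dots> = frob (int (nat (j mod int n) + nat (i mod int n))) x"
    by (rule power_q_power)
  also have "\<dots> = frob (i + j) x"
    using n_pos by (simp add: frob_def mod_add_eq add.commute)
  finally show ?thesis .
qed

lemma frob_cong: "i mod int n = j mod int n \<Longrightarrow> frob i = frob j"
  by (auto simp: frob_def)

lemma frob_id [simp]: "frob 0 x = x"
  by (simp add: frob_def)

lemma frob_mult: "frob i (x * y) = frob i x * frob i y"
  by (simp add: frob_def power_mult_distrib)

lemma frob_sum: "frob i (\<Sum>j\<in>A. f j) = (\<Sum>j\<in>A. frob i (f j))"
proof -
  obtain r where "q = CHAR('a) ^ r" by (rule q_eq_CHAR_power)
  thus ?thesis unfolding frob_def
    by (intro freshmans_dream_sum'[OF prime_CHAR, of _ "r * nat (i mod int n)"])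
       (simp add: power_mult)
qed

lemma frob_add: "frob i (x + y) = frob i x + frob i y"
  using frob_sum[of i "\<lambda>b. if b then x else y" UNIV] by (simp add: UNIV_bool add.commute)

lemma frob_eq_0_iff [simp]: "frob i x = 0 \<longleftrightarrow> x = 0"
  using q_gt_1 by (simp add: frob_def)

lemma frob_0_right [simp]: "frob i 0 = 0"
  by simp

section \<open>Linear independence of Frobenius powers\<close>

abbreviation Z :: "int set" where "Z \<equiv> {0..<int n}"

lemma sum_Z_nat: "(\<Sum>i\<in>Z. f i) = (\<Sum>i<n. f (int i))"
  by (rule sum.reindex_bij_witness[of _ int nat]) auto

text \<open>The associated polynomial has degree at most \<open>q ^ (n - 1)\<close>, less than the
  number of its roots.\<close>

lemma frob_coeffs_zero:
  assumes "\<And>x. (\<Sum>l\<in>Z. c l * frob l x) = 0" and "l \<in> Z"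
  shows "c l = 0"
proof -
  define p where "p = (\<Sum>i<n. Polynomial.monom (c (int i)) (q ^ i))"
  have "p = 0"
  proof (rule poly_eqI_degree[of UNIV])
    show "poly p x = poly 0 x" for x
      using assms(1)[of x] by (simp add: p_def poly_sum poly_monom sum_Z_nat power_q_power)
    have "degree p \<le> q ^ (n - 1)"
      unfolding p_def using q_gt_1
      by (intro degree_sum_le order.trans[OF degree_monom_le] power_increasing) auto
    also have "\<dots> < q ^ n"
      using q_gt_1 n_pos by (intro power_strict_increasing) auto
    finally show "degree p < card (UNIV :: 'a set)" by (simp add: card_UNIV)
    show "degree (0 :: 'a poly) < card (UNIV :: 'a set)"
      by (simp add: finite_UNIV_card_ge_0)
  qed
  moreover have "poly.coeff p (q ^ nat l) = c l"
    using assms(2) q_gt_1 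
    by (auto simp: p_def coeff_sum coeff_monom nat_less_iff intro!: sum.remove[THEN trans, of _ "nat l"] sum.neutral)
  ultimately show ?thesis by simp
qed

text \<open>Functions on residues modulo \<open>n\<close>, kept as functions on the
  integers.\<close>

definition periodic :: "(int \<Rightarrow> 'b) \<Rightarrow> bool" where
  "periodic f \<longleftrightarrow> (\<forall>i j. i mod int n = j mod int n \<longrightarrow> f i = f j)"

lemma periodicD: "periodic f \<Longrightarrow> int n dvd i - j \<Longrightarrow> f i = f j"
  by (simp add: periodic_def mod_eq_dvd_iff)

lemma periodic_affine:
  assumes "periodic f"
  shows "periodic (\<lambda>l. f (d + t * l))"
  unfolding periodic_def
proof (intro allI impI)
  fix i j assume "i mod int n = j mod int n"
  hence "int n dvd t * (i - j)" by (intro dvd_mult) (simp add: mod_eq_dvd_iff)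
  thus "f (d + t * i) = f (d + t * j)"
    by (intro periodicD[OF assms]) (simp add: algebra_simps)
qed

lemma periodic_linear: "periodic f \<Longrightarrow> periodic (\<lambda>l. f (t * l))"
  using periodic_affine[of f 0 t] by simp

lemma periodic_shift:
  assumes "periodic f"
  shows "periodic (\<lambda>l. f (l - d))"
  unfolding periodic_def mod_eq_dvd_iff by (auto intro: periodicD[OF assms])

lemma periodic_frob: "periodic (\<lambda>l. frob l x)"
  by (simp add: periodic_def frob_def)

lemma periodic_const: "periodic (\<lambda>l. c)"
  by (simp add: periodic_def)

lemma periodic_times:
  "periodic c \<Longrightarrow> periodic c' \<Longrightarrow> periodic (\<lambda>l. c l * c' l :: 'a)"
  unfolding periodic_def by metis

lemma periodic_plus:
  "periodic c \<Longrightarrow> periodic c' \<Longrightarrow> periodic (\<lambda>l. c l + c' l :: 'a)"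
  unfolding periodic_def by metis

lemma periodic_minus:
  "periodic c \<Longrightarrow> periodic c' \<Longrightarrow> periodic (\<lambda>l. c l - c' l :: 'a)"
  unfolding periodic_def by metis

lemma periodic_frob_apply: "periodic c \<Longrightarrow> periodic (\<lambda>l. frob d (c l))"
  unfolding periodic_def by metis

lemma sum_Z_reindex:
  assumes "periodic f" and inj: "\<And>i j. int n dvd g i - g j \<Longrightarrow> int n dvd i - j"
  shows "(\<Sum>l\<in>Z. f (g l)) = (\<Sum>l\<in>Z. f l)"
proof -
  let ?g = "\<lambda>l. g l mod int n"
  have "inj_on ?g Z"
  proof
    fix i j assume "i \<in> Z" "j \<in> Z" "?g i = ?g j"
    thus "i = j" using inj[of i j] by (simp add: mod_eq_dvd_iff flip: mod_pos_pos_trivial)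
       (simp add: flip: mod_eq_dvd_iff)
  qed
  moreover have "?g ` Z \<subseteq> Z" using n_pos by auto
  ultimately have "bij_betw ?g Z Z"
    by (simp add: bij_betw_def endo_inj_surj)
  from sum.reindex_bij_betw[OF this, of f] show ?thesis
    using assms(1) by (metis (no_types, lifting) mod_mod_trivial periodic_def sum.cong)
qed

text \<open>As \<open>t\<close> is a unit modulo \<open>n\<close>, these are the same Frobenius
  powers in another order; the substitution \<open>l = t' * m\<close> restores the usual
  one.\<close>

lemma frob_coeffs_zero':
  assumes "periodic c" "coprime t (int n)"
    and "\<And>x. (\<Sum>l\<in>Z. c l * frob (t * l) x) = 0"
  shows "c l = 0"
proof -
  obtain t' where t': "[t * t' = 1] (mod int n)"
    using cong_solve_coprime_int[OF assms(2)] by blast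
  have tt': "int n dvd t * t' - 1" using t' by (simp add: cong_iff_dvd_diff)
  have cancel: "int n dvd i - j" if "int n dvd t' * i - t' * j" for i j
  proof -
    have "int n dvd t * (t' * i - t' * j) - (t * t' - 1) * (i - j)"
      by (rule dvd_diff[OF dvd_mult[OF that] dvd_mult2[OF tt']])
    thus ?thesis by (simp add: algebra_simps)
  qed
  have "(\<Sum>m\<in>Z. c (t' * m) * frob m x) = 0" for x
  proof -
    have "(\<Sum>m\<in>Z. c (t' * m) * frob m x) = (\<Sum>m\<in>Z. c (t' * m) * frob (t * (t' * m)) x)"
    proof (rule sum.cong[OF refl])
      fix m
      have "int n dvd (t * t' - 1) * m" using tt' by (rule dvd_mult2)
      hence "frob (t * (t' * m)) = frob m"
        by (intro frob_cong) (simp add: mod_eq_dvd_iff algebra_simps)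
      thus "c (t' * m) * frob m x = c (t' * m) * frob (t * (t' * m)) x" by simp
    qed
    also have "\<dots> = (\<Sum>l\<in>Z. c l * frob (t * l) x)"
    proof (rule sum_Z_reindex)
      show "periodic (\<lambda>l. c l * frob (t * l) x)"
        by (intro periodic_times periodic_linear[of "\<lambda>l. frob l x"] periodic_frob assms(1))
    qed (rule cancel)
    finally show ?thesis using assms(3) by simp
  qed
  hence "c (t' * ((t * l) mod int n)) = 0"
    by (rule frob_coeffs_zero) (use n_pos in auto)
  moreover have "c (t' * ((t * l) mod int n)) = c l"
  proof -
    have "(t' * (t * l mod int n)) mod int n = (t * t' mod int n * l) mod int n"
      by (simp add: mod_mult_right_eq mod_mult_left_eq mult_ac)
    also have "\<dots> = (1 mod int n * l) mod int n"
      using t' by (simp add: cong_def)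
    also have "\<dots> = l mod int n" by (simp add: mod_mult_left_eq)
    finally show ?thesis using assms(1) unfolding periodic_def by blast
  qed
  ultimately show ?thesis by simp
qed

end

section \<open>Composition around a single monomial\<close>

locale frob_conjugation = frobenius_field q n ty
  for q n :: nat and ty :: "'a::{field, finite} itself" +
  fixes u v :: "int \<Rightarrow> 'a"
  assumes periodic_u: "periodic u" and periodic_v: "periodic v"
begin

text \<open>\<open>K m e l\<close> is the coefficient of \<open>b ^ (q ^ l) * x ^ (q ^ m)\<close> in
  \<open>L\<^sub>1 (b * L\<^sub>2 x ^ (q ^ e))\<close>.\<close>

definition K :: "int \<Rightarrow> int \<Rightarrow> int \<Rightarrow> 'a" where
  "K m e l = u l * frob (l + e) (v (m - e - l))"

text \<open>The coefficient of \<open>x ^ (q ^ m)\<close> in the same composition, as a function of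
  \<open>b\<close>.\<close>

definition T :: "int \<Rightarrow> int \<Rightarrow> 'a \<Rightarrow> 'a" where
  "T m e b = (\<Sum>l\<in>Z. K m e l * frob l b)"

text \<open>Membership in the sumset \<open>U + V\<close>.\<close>

definition w :: "int \<Rightarrow> bool" where
  "w z \<longleftrightarrow> (\<exists>l. u l \<noteq> 0 \<and> v (z - l) \<noteq> 0)"

lemma K_cong:
  assumes "int n dvd m - m'" "int n dvd e - e'" "int n dvd l - l'"
  shows "K m e l = K m' e' l'"
proof -
  have "u l = u l'" using periodic_u assms(3) by (rule periodicD)
  moreover have "frob (l + e) = frob (l' + e')"
    using dvd_add[OF assms(3,2)] by (intro frob_cong) (simp add: mod_eq_dvd_iff algebra_simps)
  moreover have "v (m - e - l) = v (m' - e' - l')"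
    using dvd_diff[OF dvd_diff[OF assms(1,2)] assms(3)]
    by (intro periodicD[OF periodic_v]) (simp add: algebra_simps)
  ultimately show ?thesis by (simp add: K_def)
qed

lemma T_cong: "int n dvd m - m' \<Longrightarrow> T m e b = T m' e b"
  unfolding T_def by (intro sum.cong refl arg_cong2[where f = times] K_cong) auto

lemma T_zero [simp]: "T m e 0 = 0"
  by (simp add: T_def)

lemma w_cong: "w x \<Longrightarrow> int n dvd x - y \<Longrightarrow> w y"
proof -
  assume "w x" "int n dvd x - y"
  then obtain l where l: "u l \<noteq> 0" "v (x - l) \<noteq> 0" by (auto simp: w_def)
  have "v (x - l) = v (y - l)"
    using \<open>int n dvd x - y\<close> by (intro periodicD[OF periodic_v]) simp
  with l show "w y" by (auto simp: w_def)
qed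

text \<open>Frobenius powers preserve being nonzero, and the indices of \<open>u\<close> and
  \<open>v\<close> in \<open>K m e l\<close> add up to \<open>m - e\<close>.\<close>

lemma w_iff_K: "w (m - e) \<longleftrightarrow> (\<exists>l. K m e l \<noteq> 0)"
  by (simp add: w_def K_def)

lemma periodic_K: "periodic (K m e)"
  unfolding periodic_def by (auto intro!: K_cong simp: mod_eq_dvd_iff)

lemma sum_Z_shift:
  assumes "periodic f"
  shows "(\<Sum>l\<in>Z. f (l + d)) = (\<Sum>l\<in>Z. f l)"
  using assms by (rule sum_Z_reindex) simp

lemma conjugate_monomial:
  "(\<Sum>l\<in>Z. u l * frob l (b * frob e (\<Sum>j\<in>Z. v j * frob j x))) = (\<Sum>m\<in>Z. T m e b * frob m x)"
proof -
  have "frob (l + e) (\<Sum>j\<in>Z. v j * frob j x) = (\<Sum>m\<in>Z. frob (l + e) (v (m - e - l)) * frob m x)" for l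
  proof -
    have "frob (l + e) (\<Sum>j\<in>Z. v j * frob j x)
        = (\<Sum>j\<in>Z. frob (l + e) (v j) * frob (l + e + j) x)"
      by (simp add: frob_sum frob_mult frob_frob)
    \<comment> \<open>Substitute \<open>j = m - e - l\<close>, so that the exponent
      \<open>l + e + j\<close> becomes \<open>m\<close>.\<close>
    also have "\<dots> = (\<Sum>m\<in>Z. frob (l + e) (v (m + (- e - l))) * frob (l + e + (m + (- e - l))) x)"
      by (intro sum_Z_shift[symmetric, of "\<lambda>j. frob (l + e) (v j) * frob (l + e + j) x"] periodic_times
        periodic_frob_apply periodic_v periodic_affine[of "\<lambda>l. frob l x" _ 1, simplified] periodic_frob)
    finally show ?thesis by (simp add: algebra_simps)
  qed
  hence "(\<Sum>l\<in>Z. u l * frob l (b * frob e (\<Sum>j\<in>Z. v j * frob j x)))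
      = (\<Sum>l\<in>Z. \<Sum>m\<in>Z. K m e l * frob l b * frob m x)"
    by (simp add: frob_mult frob_frob sum_distrib_left K_def mult_ac)
  also have "\<dots> = (\<Sum>m\<in>Z. T m e b * frob m x)"
    by (subst sum.swap) (simp add: T_def sum_distrib_right)
  finally show ?thesis .
qed

text \<open>Rewrites the twist term of the first code in powers \<open>frob l b\<close>, so that
  coefficients can be compared; \<open>frob_T\<close> does this for the second code.\<close>

lemma T_mult_frob: "T m e (c * frob d b) = (\<Sum>l\<in>Z. K m e (l - d) * frob (l - d) c * frob l b)"
proof -
  let ?f = "\<lambda>l. K m e (l - d) * frob (l - d) c * frob l b"
  have "periodic ?f"
    by (intro periodic_times periodic_shift[of "K m e"] periodic_shift[of "\<lambda>l. frob l c"] periodic_K periodic_frob)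
  from sum_Z_shift[OF this, of d] show ?thesis
    by (simp add: T_def frob_mult frob_frob mult_ac add.commute)
qed

lemma frob_T: "frob d (T m e b) = (\<Sum>l\<in>Z. frob d (K m e (l - d)) * frob l b)"
proof -
  let ?f = "\<lambda>l. frob d (K m e (l - d)) * frob l b"
  have "periodic ?f"
    by (intro periodic_times periodic_frob_apply periodic_shift[of "K m e"] periodic_K periodic_frob)
  from sum_Z_shift[OF this, of d] show ?thesis
    by (simp add: T_def frob_sum frob_mult frob_frob add.commute)
qed

lemma coeffs_zero:
  assumes "periodic c" "\<And>b. (\<Sum>l\<in>Z. c l * frob l b) = 0"
  shows "c l = 0"
  using frob_coeffs_zero'[OF assms(1), of 1] assms(2) by simp

end

section \<open>Support constraints from the inclusion of codes\<close>

text \<open>The field automorphism is already absorbed: \<open>\<eta>\<close> stands for the image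
  of the first twist under it.\<close>

locale twisted_inclusion = frob_conjugation q n ty u v
  for q n :: nat and ty :: "'a::{field, finite} itself" and u v +
  fixes k :: nat and s t :: int and g h :: nat and \<eta> \<theta> :: 'a
  assumes k: "0 < k" "k < n" and coprime_t: "coprime t (int n)"
    and inclusion: "\<And>a. \<exists>b. \<forall>x.
      (\<Sum>l\<in>Z. u l * frob l (let y = \<Sum>j\<in>Z. v j * frob j x in
         (\<Sum>i<k. a i * frob (s * int i) y) + \<eta> * frob (int g) (a 0) * frob (s * int k) y))
      = (\<Sum>i<k. b i * frob (t * int i) x) + \<theta> * frob (int h) (b 0) * frob (t * int k) x"
begin

text \<open>The coefficient of \<open>x ^ (q ^ m)\<close> in the image of the word with coefficients
  \<open>a\<close>.\<close>

definition coeff_of :: "(nat \<Rightarrow> 'a) \<Rightarrow> int \<Rightarrow> 'a" where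
  "coeff_of a m = (\<Sum>i<k. T m (s * int i) (a i)) + T m (s * int k) (\<eta> * frob (int g) (a 0))"

lemma conjugate_twisted:
  "(\<Sum>l\<in>Z. u l * frob l (let y = \<Sum>j\<in>Z. v j * frob j x in
         (\<Sum>i<k. a i * frob (s * int i) y) + \<eta> * frob (int g) (a 0) * frob (s * int k) y))
   = (\<Sum>m\<in>Z. coeff_of a m * frob m x)"
proof -
  define y where "y = (\<Sum>j\<in>Z. v j * frob j x)"
  have "(\<Sum>l\<in>Z. u l * frob l ((\<Sum>i<k. a i * frob (s * int i) y)
            + \<eta> * frob (int g) (a 0) * frob (s * int k) y))
      = (\<Sum>i<k. \<Sum>l\<in>Z. u l * frob l (a i * frob (s * int i) y))
        + (\<Sum>l\<in>Z. u l * frob l (\<eta> * frob (int g) (a 0) * frob (s * int k) y))"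
    by (subst sum.swap) (simp add: frob_add frob_sum sum_distrib_left distrib_left sum.distrib)
  also have "\<dots> = (\<Sum>i<k. \<Sum>m\<in>Z. T m (s * int i) (a i) * frob m x)
      + (\<Sum>m\<in>Z. T m (s * int k) (\<eta> * frob (int g) (a 0)) * frob m x)"
    unfolding y_def conjugate_monomial ..
  also have "\<dots> = (\<Sum>m\<in>Z. coeff_of a m * frob m x)"
    by (subst sum.swap) (simp add: coeff_of_def distrib_right sum_distrib_right sum.distrib)
  finally show ?thesis by (simp add: y_def Let_def)
qed

lemma periodic_coeff_of: "periodic (coeff_of a)"
proof -
  have "T m e b = T m' e b" if "m mod int n = m' mod int n" for m m' e b
    using that by (intro T_cong) (simp add: mod_eq_dvd_iff)
  thus ?thesis unfolding periodic_def coeff_of_def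
    by (intro allI impI arg_cong2[where f = plus] sum.cong refl)
qed

lemma coeff_of_twisted:
  shows "\<And>i. k < i \<Longrightarrow> i < n \<Longrightarrow> coeff_of a (t * int i) = 0"
    and "coeff_of a (t * int k) = \<theta> * frob (int h) (coeff_of a 0)"
proof -
  obtain b where b: "(\<Sum>m\<in>Z. coeff_of a m * frob m x)
      = (\<Sum>i<k. b i * frob (t * int i) x) + \<theta> * frob (int h) (b 0) * frob (t * int k) x" for x
    using inclusion[of a] unfolding conjugate_twisted by blast
  \<comment> \<open>The coefficients of the second word, indexed by multipliers of \<open>t\<close>.
    Since \<open>0 < k < n\<close>, positions 0 and \<open>k\<close> are different residues.
    Independence of the \<open>frob (t * l)\<close> then equates \<open>d l\<close> with
    \<open>coeff_of a (t * l)\<close>.\<close>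
  define d where "d i = (let r = nat (i mod int n) in
    if r < k then b r else if r = k then \<theta> * frob (int h) (b 0) else 0)" for i
  have per_d: "periodic d" by (simp add: periodic_def d_def)
  have d_k: "d (int k) = \<theta> * frob (int h) (b 0)" and d_lt: "i < k \<Longrightarrow> d (int i) = b i"
    and d_gt: "k < i \<Longrightarrow> i < n \<Longrightarrow> d (int i) = 0" for i
    using k by (simp_all add: d_def)
  have "coeff_of a (t * l) - d l = 0" for l
  proof (rule frob_coeffs_zero'[OF _ coprime_t])
    show "periodic (\<lambda>l. coeff_of a (t * l) - d l)"
      by (intro periodic_minus periodic_linear[of "coeff_of a"] periodic_coeff_of per_d)
    fix x
    have "(\<Sum>l\<in>Z. d l * frob (t * l) x) = (\<Sum>i<n. d (int i) * frob (t * int i) x)"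
      by (rule sum_Z_nat)
    also have "\<dots> = (\<Sum>i\<le>k. d (int i) * frob (t * int i) x)"
      using k d_gt by (intro sum.mono_neutral_right) auto
    also have "\<dots> = (\<Sum>i<k. b i * frob (t * int i) x) + \<theta> * frob (int h) (b 0) * frob (t * int k) x"
      by (simp add: d_lt d_k flip: lessThan_Suc_atMost)
    also have "\<dots> = (\<Sum>m\<in>Z. coeff_of a m * frob m x)"
      by (simp add: b)
    also have "\<dots> = (\<Sum>l\<in>Z. coeff_of a (t * l) * frob (t * l) x)"
    proof (rule sum_Z_reindex[symmetric])
      show "periodic (\<lambda>m. coeff_of a m * frob m x)"
        by (intro periodic_times periodic_coeff_of periodic_frob)
      show "int n dvd i - j" if "int n dvd t * i - t * j" for i j
        using that coprime_t by (simp add: coprime_commute coprime_dvd_mult_right_iff flip: right_diff_distrib)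
    qed
    finally show "(\<Sum>l\<in>Z. (coeff_of a (t * l) - d l) * frob (t * l) x) = 0"
      by (simp add: left_diff_distrib sum_subtractf)
  qed
  hence c: "coeff_of a (t * l) = d l" for l by simp
  show "coeff_of a (t * int i) = 0" if "k < i" "i < n" for i
    using c d_gt that by simp
  show "coeff_of a (t * int k) = \<theta> * frob (int h) (coeff_of a 0)"
    using c[of "int k"] c[of 0] d_k d_lt[of 0] k by simp
qed

text \<open>The exponents \<open>s * e\<close> with \<open>lo \<le> e < k\<close> have an unconstrained coefficient in the first code,
  and the exponents \<open>t * i\<close> with \<open>hi \<le> i < n\<close> do not occur in the second one.\<close>

definition lo :: nat where "lo = (if \<eta> = 0 then 0 else 1)"
definition hi :: nat where "hi = (if \<theta> = 0 then k else Suc k)"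

text \<open>For nonzero \<open>\<eta>\<close>, the position \<open>e = 0\<close> would add a twist
  term; \<open>lo\<close> excludes it.\<close>

lemma coeff_of_single:
  assumes "lo \<le> e" "e < k"
  shows "coeff_of (\<lambda>i. if i = e then b else 0) m = T m (s * int e) b"
proof -
  have "(\<Sum>i<k. T m (s * int i) (if i = e then b else 0)) = (\<Sum>i<k. if i = e then T m (s * int i) b else 0)"
    by (intro sum.cong) auto
  moreover have "\<eta> = 0 \<or> e \<noteq> 0" using assms by (auto simp: lo_def split: if_splits)
  ultimately show ?thesis using assms by (auto simp: coeff_of_def)
qed

lemma coeff_of_vanish:
  assumes "hi \<le> i" "i < n"
  shows "coeff_of a (t * int i) = 0"
  using assms coeff_of_twisted(1)[of i a] coeff_of_twisted(2)[of a]
  by (cases "i = k") (auto simp: hi_def split: if_splits)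

text \<open>A coefficient vanishing for every \<open>b\<close> is zero as a
  \<open>q\<close>-polynomial in \<open>b\<close>, so all its \<open>K\<close> vanish.\<close>

lemma not_w:
  assumes "lo \<le> e" "e < k" "hi \<le> i" "i < n"
  shows "\<not> w (t * int i - s * int e)"
proof -
  have "T (t * int i) (s * int e) b = 0" for b
    using coeff_of_vanish[OF assms(3,4)] coeff_of_single[OF assms(1,2), of b] by metis
  hence "K (t * int i) (s * int e) l = 0" for l
    unfolding T_def by (rule coeffs_zero[OF periodic_K])
  thus ?thesis by (simp add: w_iff_K)
qed

text \<open>For a free monomial, the twist relation of the second code makes \<open>K\<close> at
  exponent \<open>t * int k\<close> equal to \<open>\<theta>\<close> times a Frobenius image of
  \<open>K\<close> at exponent 0, with \<open>l\<close> shifted by \<open>h\<close>. Both vanish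
  together.\<close>

lemma w_twist_iff:
  assumes "\<theta> \<noteq> 0" "lo \<le> e" "e < k"
  shows "w (t * int k - s * int e) \<longleftrightarrow> w (- (s * int e))"
proof -
  let ?c = "\<lambda>l. K (t * int k) (s * int e) l - \<theta> * frob (int h) (K 0 (s * int e) (l - int h))"
  have "T (t * int k) (s * int e) b = \<theta> * frob (int h) (T 0 (s * int e) b)" for b
    using coeff_of_twisted(2) coeff_of_single[OF assms(2,3), of b] by metis
  hence "(\<Sum>l\<in>Z. ?c l * frob l b) = 0" for b
    by (simp add: frob_T left_diff_distrib sum_subtractf mult.assoc flip: T_def sum_distrib_left)
  moreover have "periodic ?c"
    by (intro periodic_minus periodic_K periodic_times periodic_const
      periodic_frob_apply periodic_shift[of "K 0 (s * int e)"])
  ultimately have "?c l = 0" for l by (rule coeffs_zero[rotated])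
  hence "K (t * int k) (s * int e) l = 0 \<longleftrightarrow> K 0 (s * int e) (l - int h) = 0" for l
    using assms(1) by (metis eq_iff_diff_eq_0 frob_eq_0_iff mult_eq_0_iff)
  hence "(\<exists>l. K (t * int k) (s * int e) l \<noteq> 0) \<longleftrightarrow> (\<exists>l. K 0 (s * int e) l \<noteq> 0)"
    by (metis add_diff_cancel_right')
  thus ?thesis using w_iff_K[of 0 "s * int e"] by (simp add: w_iff_K)
qed

text \<open>The first coefficient of a word recurs in its twist term. At an exponent absent from the
  second code the two contributions cancel, so their \<open>K\<close> vanish together up to a shift
  of \<open>l\<close> by \<open>g\<close>.\<close>

lemma w_untwist_iff:
  assumes "\<eta> \<noteq> 0" "hi \<le> i" "i < n"
  shows "w (t * int i) \<longleftrightarrow> w (t * int i - s * int k)"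
proof -
  let ?m = "t * int i"
  let ?c = "\<lambda>l. K ?m 0 l + K ?m (s * int k) (l - int g) * frob (l - int g) \<eta>"
  have "coeff_of (\<lambda>i. if i = 0 then b else 0) ?m = T ?m 0 b + T ?m (s * int k) (\<eta> * frob (int g) b)" for b
  proof -
    have "(\<Sum>i<k. T ?m (s * int i) (if i = 0 then b else 0)) = (\<Sum>i<k. if i = 0 then T ?m 0 b else 0)"
      by (intro sum.cong) auto
    thus ?thesis using k by (simp add: coeff_of_def)
  qed
  hence "T ?m 0 b + T ?m (s * int k) (\<eta> * frob (int g) b) = 0" for b
    using coeff_of_vanish[OF assms(2,3)] by metis
  hence "(\<Sum>l\<in>Z. ?c l * frob l b) = 0" for b
    by (simp add: T_mult_frob distrib_right sum.distrib flip: T_def)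
  moreover have "periodic ?c"
    by (intro periodic_plus periodic_times periodic_K periodic_shift[of "K ?m (s * int k)"]
      periodic_shift[of "\<lambda>l. frob l \<eta>"] periodic_frob)
  ultimately have c: "?c l = 0" for l by (rule coeffs_zero[rotated])
  have "K ?m 0 l = 0 \<longleftrightarrow> K ?m (s * int k) (l - int g) = 0" for l
  proof -
    have "K ?m 0 l = - (K ?m (s * int k) (l - int g) * frob (l - int g) \<eta>)"
      using c[of l] by (simp add: add_eq_0_iff)
    thus ?thesis using assms(1) by simp
  qed
  hence "(\<exists>l. K ?m 0 l \<noteq> 0) \<longleftrightarrow> (\<exists>l. K ?m (s * int k) l \<noteq> 0)"
    by (metis add_diff_cancel_right')
  thus ?thesis using w_iff_K[of ?m 0] by (simp add: w_iff_K)
qed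

end

section \<open>The cases \<open>k = 2\<close> and \<open>k = n - 2\<close>\<close>

text \<open>For these moduli the only units are 1 and -1, so any two units agree up to sign.\<close>

lemma coprime_small_cases:
  fixes s N :: int
  assumes "coprime s N" "N \<in> {1, 2, 3, 4, 6}"
  shows "N dvd s - 1 \<or> N dvd s + 1"
proof -
  have "\<not> p dvd s" if "p dvd N" "\<bar>p\<bar> \<noteq> 1" for p
    using coprime_common_divisor[OF assms(1) _ that(1)] that(2) by auto
  from this[of 2] this[of 3] show ?thesis
    using assms(2) by (elim insertE emptyE; simp; presburger)
qed

lemma multiple_of_unit_mod:
  fixes t z :: int
  assumes "coprime t (int n)" "0 < n"
  obtains i where "i < n" "int n dvd z - t * int i"
proof -
  obtain t' where t': "[t * t' = 1] (mod int n)"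
    using cong_solve_coprime_int[OF assms(1)] by blast
  define i where "i = nat (t' * z mod int n)"
  have i: "int i = t' * z mod int n" using assms(2) by (simp add: i_def)
  have "[t * int i = t * (t' * z)] (mod int n)"
    unfolding i by (intro cong_mult) (simp_all add: cong_def)
  also have "[t * (t' * z) = z] (mod int n)"
    using cong_mult[OF t' cong_refl[of z]] by (simp add: mult.assoc)
  finally have "int n dvd z - t * int i"
    by (simp add: cong_iff_dvd_diff dvd_diff_commute)
  moreover have "i < n" using assms(2) by (simp add: i_def nat_less_iff)
  ultimately show thesis using that by blast
qed

context twisted_inclusion
begin

lemma w_cong_iff: "int n dvd x - y \<Longrightarrow> w x \<longleftrightarrow> w y"
  using w_cong[of x y] w_cong[of y x] by (auto simp: dvd_diff_commute)

lemma not_w_2: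
  assumes "k = 2" and n: "n = 5 \<or> n \<ge> 7" and "coprime s (int n)"
    and "\<not> int n dvd s - t" "\<not> int n dvd s + t" and "\<eta> = 0 \<or> \<theta> = 0 \<or> n \<noteq> 5"
  shows "\<not> w z"
proof (rule no_sumset_support[of "int n" s t "\<eta> \<noteq> 0" "\<theta> \<noteq> 0" w])
  let ?P = "\<lambda>z. \<exists>c\<in>(if \<theta> \<noteq> 0 then {0, 1, 2} else {0, 1}). int n dvd z - c * t"
  \<comment> \<open>Write \<open>z\<close> as \<open>t * int i\<close> modulo \<open>n\<close>:
    either \<open>i < hi\<close>, which is \<open>P\<close>, or the exponent is absent from the
    second code.\<close>
  have index: "?P z \<or> (\<exists>i. hi \<le> i \<and> i < n \<and> int n dvd z - t * int i)" for z
  proof -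
    obtain i where i: "i < n" "int n dvd z - t * int i"
      using multiple_of_unit_mod[OF coprime_t n_pos] .
    show ?thesis
    proof (cases "hi \<le> i")
      case False
      hence "int i \<in> (if \<theta> \<noteq> 0 then {0, 1, 2} else {0, 1})"
        using \<open>k = 2\<close> unfolding hi_def by (auto split: if_splits)
      thus ?thesis using i(2) by (auto simp: mult.commute)
    qed (use i in blast)
  qed
  show "?P (z + s)" if "w z" for z
  proof (rule ccontr)
    assume "\<not> ?thesis"
    then obtain i where i: "hi \<le> i" "i < n" "int n dvd z + s - t * int i"
      using index by blast
    have "w (t * int i - s * int 1)"
      using w_cong[OF that] i(3) by (simp add: algebra_simps)
    \<comment> \<open>Position 1 is free whether or not there is a twist.\<close>
    moreover have "lo \<le> 1" by (simp add: lo_def)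
    ultimately show False using not_w[of 1 i] i \<open>k = 2\<close> by simp
  qed
  show "?P z \<or> \<eta> \<noteq> 0 \<and> w (z - 2 * s)" if "w z" for z
  proof (subst disj_imp, rule impI)
    assume "\<not> ?P z"
    then obtain i where i: "hi \<le> i" "i < n" "int n dvd z - t * int i"
      using index by blast
    have w: "w (t * int i)" using w_cong[OF that i(3)] .
    have \<eta>: "\<eta> \<noteq> 0" using not_w[of 0 i] w i \<open>k = 2\<close> by (auto simp: lo_def)
    hence "w (t * int i - s * int k)" using w_untwist_iff i w by blast
    moreover have "int n dvd (t * int i - s * int k) - (z - 2 * s)"
      using i(3) \<open>k = 2\<close> by (simp add: dvd_diff_commute algebra_simps)
    ultimately show "\<eta> \<noteq> 0 \<and> w (z - 2 * s)" using \<eta> w_cong by blast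
  qed
  show "?P (z + 2 * s) \<or> w (z + 2 * s)" if "\<eta> \<noteq> 0" "w z" for z
  proof (subst disj_imp, rule impI)
    assume "\<not> ?P (z + 2 * s)"
    then obtain i where i: "hi \<le> i" "i < n" "int n dvd z + 2 * s - t * int i"
      using index by blast
    have "w (t * int i - s * int k)"
      using w_cong[OF that(2)] i(3) \<open>k = 2\<close> by (simp add: algebra_simps)
    hence "w (t * int i)" using w_untwist_iff that(1) i by blast
    thus "w (z + 2 * s)" using w_cong i(3) by (simp add: dvd_diff_commute)
  qed
  show "w (2 * t - s) \<longleftrightarrow> w (- s)" if "\<theta> \<noteq> 0"
    using w_twist_iff[OF that, of 1] \<open>k = 2\<close> by (simp add: lo_def mult.commute)
qed (use assms coprime_t in \<open>auto intro: w_cong\<close>)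

text \<open>The reflection \<open>z \<mapsto> 2 * s - 2 * t - z\<close> turns the constraints for \<open>k = n - 2\<close> into those
  for \<open>k = 2\<close> with the roles of the two codes exchanged.\<close>

lemma not_w_n_minus_2:
  assumes "k = n - 2" and n: "n = 5 \<or> n \<ge> 7" and coprime_s: "coprime s (int n)"
    and "\<not> int n dvd s - t" "\<not> int n dvd s + t" and "\<eta> = 0 \<or> \<theta> = 0 \<or> n \<noteq> 5"
  shows "\<not> w z"
proof -
  let ?w = "\<lambda>z. w (2 * s - 2 * t - z)"
  let ?P = "\<lambda>z. \<exists>c\<in>(if \<eta> \<noteq> 0 then {0, 1, 2} else {0, 1}). int n dvd z - c * s"
  have k_int: "int k = int n - 2" using \<open>k = n - 2\<close> n by auto
  have n1: "hi \<le> n - 1" "n - 1 < n" "int (n - 1) = int n - 1"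
    unfolding hi_def using \<open>k = n - 2\<close> n by auto
  \<comment> \<open>Counted from \<open>2 * s\<close>, the multipliers that are not free, namely
    \<open>n - 2\<close>, \<open>n - 1\<close> and, for a nonzero twist, 0, turn into 0, 1 and 2
    modulo \<open>n\<close>.\<close>
  have index: "?P z \<or> (\<exists>e. lo \<le> e \<and> e < k \<and> int n dvd z - 2 * s - s * int e)" for z
  proof -
    obtain e where e: "e < n" "int n dvd (z - 2 * s) - s * int e"
      using multiple_of_unit_mod[OF coprime_s n_pos] .
    have P: "?P z" if "c \<in> (if \<eta> \<noteq> 0 then {0, 1, 2} else {0, 1})" "int e + 2 = c + d * int n" for c d
    proof -
      have "z - c * s = (z - 2 * s - s * int e) + int n * (d * s)"
      proof -
        have "z - 2 * s - s * int e = z - (int e + 2) * s" by (simp add: algebra_simps)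
        thus ?thesis unfolding that(2) by (simp add: algebra_simps)
      qed
      hence "int n dvd z - c * s" using e(2) by (metis dvd_add dvd_triv_left)
      thus ?thesis using that(1) by blast
    qed
    consider "lo \<le> e" "e < k" | "\<eta> \<noteq> 0" "e = 0" | "e = n - 2" | "e = n - 1"
    proof -
      have "e < k \<or> e = n - 2 \<or> e = n - 1" using e(1) \<open>k = n - 2\<close> by linarith
      moreover have "lo \<le> e \<or> \<eta> \<noteq> 0 \<and> e = 0" by (auto simp: lo_def)
      ultimately show thesis using that by blast
    qed
    thus ?thesis
    proof cases
      case 1
      thus ?thesis using e(2) by blast
    next
      case 2
      thus ?thesis using P[of 2 0] by auto
    next
      case 3
      thus ?thesis using P[of 0 1] n by auto
    next
      case 4
      thus ?thesis using P[of 1 1] n by auto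
    qed
  qed
  have "\<not> ?w (2 * s - 2 * t - z)"
  proof (rule no_sumset_support[of "int n" t s "\<theta> \<noteq> 0" "\<eta> \<noteq> 0" ?w])
    show "?w y" if "?w x" "int n dvd x - y" for x y
      using w_cong[OF that(1)] that(2) by (simp add: dvd_diff_commute)
    show "?P (z + t)" if "?w z" for z
    proof (rule ccontr)
      assume "\<not> ?thesis"
      then obtain e where e: "lo \<le> e" "e < k" "int n dvd z + t - 2 * s - s * int e"
        using index by blast
      \<comment> \<open>The exponent \<open>t * int (n - 1)\<close>, congruent to
        \<open>- t\<close>, is always absent from the second code.\<close>
      have "int n dvd (2 * s - 2 * t - z) - (t * int (n - 1) - s * int e)"
      proof -
        have "(2 * s - 2 * t - z) - (t * int (n - 1) - s * int e)
            = int n * (- t) - (z + t - 2 * s - s * int e)"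
          unfolding n1 by (simp add: algebra_simps)
        thus ?thesis using e(3) by (metis dvd_diff dvd_triv_left)
      qed
      hence "w (t * int (n - 1) - s * int e)" by (rule w_cong[OF that])
      thus False using not_w e n1 by blast
    qed
    \<comment> \<open>As \<open>k\<close> is -2 modulo \<open>n\<close>, the reflection sends
      \<open>z\<close> and \<open>z - 2 * t\<close> to the two sides of \<open>w_twist_iff\<close>,
      which thus supplies \<open>down\<close> and \<open>up\<close>.\<close>
    have twist: "int n dvd (2 * s - 2 * t - z) - (t * int k - s * int e)"
      "int n dvd (2 * s - 2 * t - (z - 2 * t)) - (- (s * int e))"
      if "int n dvd z - 2 * s - s * int e" for z e
    proof -
      have "(2 * s - 2 * t - z) - (t * int k - s * int e)
          = int n * (- t) - (z - 2 * s - s * int e)"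
        unfolding k_int by (simp add: algebra_simps)
      thus "int n dvd (2 * s - 2 * t - z) - (t * int k - s * int e)"
        using that by (metis dvd_diff dvd_triv_left)
      have "(2 * s - 2 * t - (z - 2 * t)) - (- (s * int e)) = - (z - 2 * s - s * int e)"
        by simp
      thus "int n dvd (2 * s - 2 * t - (z - 2 * t)) - (- (s * int e))"
        using that by (metis dvd_minus_iff)
    qed
    show "?P z \<or> \<theta> \<noteq> 0 \<and> ?w (z - 2 * t)" if "?w z" for z
    proof (subst disj_imp, rule impI)
      assume "\<not> ?P z"
      then obtain e where e: "lo \<le> e" "e < k" "int n dvd z - 2 * s - s * int e"
        using index by blast
      have w: "w (t * int k - s * int e)" using w_cong[OF that twist(1)[OF e(3)]] .
      have \<theta>: "\<theta> \<noteq> 0" using not_w[OF e(1,2), of k] w k by (auto simp: hi_def)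
      hence "w (- (s * int e))" using w_twist_iff e w by blast
      thus "\<theta> \<noteq> 0 \<and> ?w (z - 2 * t)" using \<theta> w_cong_iff[OF twist(2)[OF e(3)]] by blast
    qed
    show "?P (z + 2 * t) \<or> ?w (z + 2 * t)" if "\<theta> \<noteq> 0" "?w z" for z
    proof (subst disj_imp, rule impI)
      assume "\<not> ?P (z + 2 * t)"
      then obtain e where e: "lo \<le> e" "e < k" "int n dvd (z + 2 * t) - 2 * s - s * int e"
        using index by blast
      have "w (- (s * int e))" using w_cong[OF _ twist(2)[OF e(3)]] that(2) by simp
      hence "w (t * int k - s * int e)" using w_twist_iff[OF that(1)] e by blast
      thus "?w (z + 2 * t)" using w_cong_iff[OF twist(1)[OF e(3)]] by blast
    qed
    \<comment> \<open>Modulo \<open>n\<close> the reflected points are the two sides of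
      \<open>w_untwist_iff\<close> at \<open>i = n - 1\<close>.\<close>
    show "?w (2 * s - t) \<longleftrightarrow> ?w (- t)" if "\<eta> \<noteq> 0"
    proof -
      have "int n dvd (2 * s - 2 * t - (2 * s - t)) - t * int (n - 1)"
        "int n dvd (2 * s - 2 * t - (- t)) - (t * int (n - 1) - s * int k)"
        unfolding n1 k_int by (simp_all add: algebra_simps)
      from this[THEN w_cong_iff] show ?thesis
        using w_untwist_iff[OF that n1(1,2)] by blast
    qed
  qed (use assms coprime_t in \<open>auto simp: dvd_diff_commute add.commute\<close>)
  thus ?thesis by simp
qed

end

section \<open>From polynomials to functions\<close>

lemma field_aut_0:
  assumes "field_aut_on UNIV (\<rho> :: 'a::field \<Rightarrow> 'a)"
  shows "\<rho> 0 = 0"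
proof -
  have "\<rho> (0 + 0) = \<rho> 0 + \<rho> 0"
    using assms by (auto simp: field_aut_on_def simp del: add_0_left add_0_right)
  thus ?thesis by (metis add_cancel_right_right add_0)
qed

text \<open>As \<open>\<rho>\<close> is onto, this determines the function of
  \<open>map_poly \<rho> f\<close> everywhere.\<close>

lemma poly_map_poly_aut:
  assumes "field_aut_on UNIV (\<rho> :: 'a::field \<Rightarrow> 'a)"
  shows "poly (map_poly \<rho> f) (\<rho> x) = \<rho> (poly f x)"
proof -
  have add: "\<rho> (a + b) = \<rho> a + \<rho> b" and mult: "\<rho> (a * b) = \<rho> a * \<rho> b" for a b
    using assms by (auto simp: field_aut_on_def)
  show ?thesis
    by (induction f) (simp_all add: map_poly_pCons field_aut_0[OF assms] add mult)
qed

lemma field_aut_power: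
  assumes "field_aut_on UNIV (\<rho> :: 'a::field \<Rightarrow> 'a)"
  shows "\<rho> (x ^ m) = \<rho> x ^ m"
proof -
  have mult: "\<rho> (a * b) = \<rho> a * \<rho> b" for a b
    using assms by (auto simp: field_aut_on_def)
  have "inj \<rho>"
    using assms by (auto simp: field_aut_on_def bij_betw_def)
  hence "\<rho> 1 \<noteq> 0" by (metis injD zero_neq_one field_aut_0[OF assms])
  hence "\<rho> 1 = 1" using mult[of 1 1] by simp
  thus ?thesis by (induction m) (simp_all add: mult)
qed

context frobenius_field
begin

text \<open>Every field element is a root of the modulus, so reduction is invisible to
  evaluation.\<close>

lemma poly_mod_q_modulus: "poly (p mod q_modulus q n) (x :: 'a) = poly p x"
proof -
  have "poly (q_modulus q n) x = 0"
    using power_q_power[of x n] by (simp add: q_modulus_def poly_monom frob_def)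
  moreover have "poly p x = poly (p div q_modulus q n * q_modulus q n + p mod q_modulus q n) x"
    by (simp only: div_mult_mod_eq)
  ultimately show ?thesis by (simp only: poly_add poly_mult mult_zero_right add_0_left)
qed

lemma perm_q_poly_frob:
  assumes "L \<in> perm_q_polys q n"
  obtains u i where "periodic u" "u i \<noteq> 0" "\<And>x :: 'a. poly L x = (\<Sum>l\<in>Z. u l * frob l x)"
proof -
  obtain a where L: "L = (\<Sum>i<n. Polynomial.monom (a i) (q ^ i))" and bij: "bij (poly L)"
    using assms by (auto simp: perm_q_polys_def q_polys_def)
  define u where "u l = a (nat (l mod int n))" for l
  have u: "poly L x = (\<Sum>l\<in>Z. u l * frob l x)" for x
    by (simp add: L poly_sum poly_monom sum_Z_nat u_def power_q_power nat_mod_distrib)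
  \<comment> \<open>Injectivity rules out the zero polynomial; this makes \<open>U\<close> and
    \<open>V\<close> nonempty.\<close>
  have "\<exists>i. u i \<noteq> 0"
  proof (rule ccontr)
    assume "\<not> ?thesis"
    hence "poly L 0 = poly L 1" by (simp add: u)
    thus False using bij by (auto dest!: bij_is_inj injD)
  qed
  moreover have "periodic u" by (simp add: periodic_def u_def)
  ultimately show thesis using u that by blast
qed

end

section \<open>Non-equivalence of the twisted codes\<close>

theorem theorem4p8:
  fixes q n k s t g h :: nat and \<eta> \<theta> :: "'a :: {field, finite}"
  assumes "primepow q"
    and "card (UNIV :: 'a set) = q ^ n"
    and "n > 0" "k > 0" "s > 0" "t > 0" "g > 0" "h > 0"
    and "gcd n s = 1" "gcd n t = 1"
    and "k \<in> {2, n - 2}"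
    and "rel_norm q n s \<eta> \<noteq> (- 1) ^ (n * k)"
    and "rel_norm q n t \<theta> \<noteq> (- 1) ^ (n * k)"
    and "\<not> [int s = int t] (mod int n)" "\<not> [int s = - int t] (mod int n)"
    and "\<eta> = 0 \<or> \<theta> = 0 \<or> n \<noteq> 5"
  shows "\<not> code_equiv q n (twisted_code q n k s \<eta> g) (twisted_code q n k t \<theta> h)"
proof
  assume "code_equiv q n (twisted_code q n k s \<eta> g) (twisted_code q n k t \<theta> h)"
  then obtain L\<^sub>1 L\<^sub>2 \<rho> where L: "L\<^sub>1 \<in> perm_q_polys q n" "L\<^sub>2 \<in> perm_q_polys q n"
    and aut: "field_aut_on UNIV \<rho>"
    and image: "twisted_code q n k t \<theta> h = {(L\<^sub>1 \<circ>\<^sub>p (map_poly \<rho> f \<circ>\<^sub>p L\<^sub>2)) mod q_modulus q n | f.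
      f \<in> twisted_code q n k s \<eta> g}"
    unfolding code_equiv_def by blast
  interpret frobenius_field q n "TYPE('a)"
    using assms by unfold_locales auto
  obtain u i where u: "periodic u" "u i \<noteq> 0" "\<And>x. poly L\<^sub>1 x = (\<Sum>l\<in>Z. u l * frob l x)"
    using perm_q_poly_frob[OF L(1)] by blast
  obtain v j where v: "periodic v" "v j \<noteq> 0" "\<And>x. poly L\<^sub>2 x = (\<Sum>l\<in>Z. v l * frob l x)"
    using perm_q_poly_frob[OF L(2)] by blast
  have bij_\<rho>: "bij \<rho>" and hom: "\<rho> (x + y) = \<rho> x + \<rho> y" "\<rho> (x * y) = \<rho> x * \<rho> y" for x y
    using aut by (auto simp: field_aut_on_def)
  have \<rho>_0: "\<rho> 0 = 0" using aut by (rule field_aut_0)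
  have \<rho>_sum: "\<rho> (\<Sum>i\<in>I. c i) = (\<Sum>i\<in>I. \<rho> (c i))" for I :: "nat set" and c
    by (induction I rule: infinite_finite_induct) (simp_all add: hom \<rho>_0)
  have \<rho>_eq_0: "\<rho> \<eta> = 0 \<longleftrightarrow> \<eta> = 0"
    using \<rho>_0 bij_\<rho> by (metis bij_is_inj injD)

  have coprime: "coprime (int s) (int n)" "coprime (int t) (int n)"
    using \<open>gcd n s = 1\<close> \<open>gcd n t = 1\<close> by (simp_all add: coprime_iff_gcd_eq_1 gcd.commute)
  have st: "\<not> int n dvd int s - int t" "\<not> int n dvd int s + int t"
    using assms by (simp_all add: cong_iff_dvd_diff)
  \<comment> \<open>For the other \<open>n\<close>, \<open>s\<close> and \<open>t\<close> would
    agree up to sign modulo \<open>n\<close>.\<close>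
  have n: "n = 5 \<or> n \<ge> 7"
  proof (rule ccontr)
    assume "\<not> ?thesis"
    hence "int n \<in> {1, 2, 3, 4, 6}" using \<open>n > 0\<close> by auto
    from coprime_small_cases[OF coprime(1) this] coprime_small_cases[OF coprime(2) this]
    have "int n dvd int s - int t \<or> int n dvd int s + int t"
      using dvd_diff[of "int n" "int s - 1" "int t - 1"] dvd_add[of "int n" "int s - 1" "int t + 1"]
        dvd_add[of "int n" "int s + 1" "int t - 1"] dvd_diff[of "int n" "int s + 1" "int t + 1"]
      by (simp add: algebra_simps) blast
    with st show False by blast
  qed

  have member: "poly f x = (\<Sum>i<k. a i * frob (int r * int i) x) + \<zeta> * frob (int d) (a 0) * frob (int r * int k) x"
    if "f = ((\<Sum>i<k. Polynomial.monom (a i) (q ^ (r * i))) + Polynomial.monom (\<zeta> * a 0 ^ (q ^ d)) (q ^ (r * k)))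
        mod q_modulus q n" for f a r \<zeta> d and x :: 'a
    unfolding that poly_mod_q_modulus by (simp add: poly_sum poly_monom power_q_power)

  interpret twisted_inclusion q n "TYPE('a)" u v k "int s" "int t" g h "\<rho> \<eta>" \<theta>
  proof unfold_locales
    show "0 < k" "k < n" using assms n by auto
    fix a :: "nat \<Rightarrow> 'a"
    \<comment> \<open>Preimages under \<open>\<rho>\<close>, so that
      \<open>map_poly \<rho> f\<close> has the prescribed coefficients \<open>a\<close> and twist
      \<open>\<rho> \<eta>\<close>.\<close>
    define a' where "a' i = inv \<rho> (a i)" for i
    have a': "\<rho> (a' i) = a i" for i
      using bij_\<rho> by (simp add: a'_def bij_is_surj surj_f_inv_f)
    define f where "f = ((\<Sum>i<k. Polynomial.monom (a' i) (q ^ (s * i)))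
      + Polynomial.monom (\<eta> * a' 0 ^ (q ^ g)) (q ^ (s * k))) mod q_modulus q n"
    have f: "poly (map_poly \<rho> f) y = (\<Sum>i<k. a i * frob (int s * int i) y)
        + \<rho> \<eta> * frob (int g) (a 0) * frob (int s * int k) y" for y
    proof -
      obtain x where y: "y = \<rho> x" using bij_\<rho> by (metis bij_is_surj surjD)
      show ?thesis
        unfolding y poly_map_poly_aut[OF aut] member[OF f_def]
        by (simp add: hom \<rho>_sum field_aut_power[OF aut] a' frob_def)
    qed
    have "f \<in> twisted_code q n k s \<eta> g"
      unfolding twisted_code_def f_def by blast
    hence "(L\<^sub>1 \<circ>\<^sub>p (map_poly \<rho> f \<circ>\<^sub>p L\<^sub>2)) mod q_modulus q n \<in> twisted_code q n k t \<theta> h"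
      unfolding image by blast
    then obtain b where b: "(L\<^sub>1 \<circ>\<^sub>p (map_poly \<rho> f \<circ>\<^sub>p L\<^sub>2)) mod q_modulus q n
      = ((\<Sum>i<k. Polynomial.monom (b i) (q ^ (t * i))) + Polynomial.monom (\<theta> * b 0 ^ (q ^ h)) (q ^ (t * k)))
        mod q_modulus q n"
      unfolding twisted_code_def by blast
    show "\<exists>b. \<forall>x. (\<Sum>l\<in>Z. u l * frob l (let y = \<Sum>j\<in>Z. v j * frob j x in
         (\<Sum>i<k. a i * frob (int s * int i) y) + \<rho> \<eta> * frob (int g) (a 0) * frob (int s * int k) y))
      = (\<Sum>i<k. b i * frob (int t * int i) x) + \<theta> * frob (int h) (b 0) * frob (int t * int k) x"
    proof (intro exI allI)
      fix x
      show "(\<Sum>l\<in>Z. u l * frob l (let y = \<Sum>j\<in>Z. v j * frob j x in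
         (\<Sum>i<k. a i * frob (int s * int i) y) + \<rho> \<eta> * frob (int g) (a 0) * frob (int s * int k) y))
        = (\<Sum>i<k. b i * frob (int t * int i) x) + \<theta> * frob (int h) (b 0) * frob (int t * int k) x"
        using member[OF b, of x] by (simp only: poly_mod_q_modulus poly_pcompose u(3) v(3) f Let_def)
    qed
  qed (use u v coprime in auto)

  \<comment> \<open>The sumset is nonempty, against both emptiness lemmas.\<close>
  have "w (i + j)" using u(2) v(2) unfolding w_def by (intro exI[of _ i]) simp
  moreover have "\<rho> \<eta> = 0 \<or> \<theta> = 0 \<or> n \<noteq> 5" using assms \<rho>_eq_0 by blast
  ultimately show False
    using not_w_2[OF _ n coprime(1) st] not_w_n_minus_2[OF _ n coprime(1) st] \<open>k \<in> {2, n - 2}\<close> by blast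
qed

end
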